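(* Every factor of a topological dynamical system with the asymptotic average shadowing property has the asymptotic average shadowing property.
   Context: A topological dynamical system $(X,T)$ consists of a compact metrizable space $X$ and a continuous map $T\colon X\to X$. Fix a compatible metric $\rho$ on $X$ of diameter at most $1$ (the notions below do not depend on this choice). A topological dynamical system $(Y,R)$ is a factor of $(X,T)$ if there is a continuous surjection $\pi\colon X\to Y$ with $\pi\circ T=R\circ\pi$. Asymptotic average pseudo-orbit in $(X,T)$: a sequence $\underline{x}=\{x_n\}_{n=0}^\infty$ in $X$ with $\limsup_{n\to\infty}\frac1n\sum_{i=0}^{n-1}\rho(T(x_i),x_{i+1})=0$. Asymptotic average shadowing property of $(X,T)$: for every asymptotic average pseudo-orbit $\underline{x}$ in $(X,T)$ there is $z\in X$ with $\limsup_{n\to\infty}\frac1n\sum_{i=0}^{n-1}\rho(T^i(z),x_i)=0$. *)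

theory Defs
  imports "HOL-Analysis.Analysis"
begin

definition dynamical_system :: "'a topology \<Rightarrow> ('a \<Rightarrow> 'a) \<Rightarrow> bool" where
  "dynamical_system X T \<longleftrightarrow> compact_space X \<and> metrizable_space X \<and> continuous_map X X T"

definition compatible_metric :: "'a topology \<Rightarrow> ('a \<Rightarrow> 'a \<Rightarrow> real) \<Rightarrow> bool" where
  "compatible_metric X \<rho> \<longleftrightarrow>
     Metric_space (topspace X) \<rho> \<and> Metric_space.mtopology (topspace X) \<rho> = X \<and>
     (\<forall>x\<in>topspace X. \<forall>y\<in>topspace X. \<rho> x y \<le> 1)"

definition factor_of ::
  "'b topology \<Rightarrow> ('b \<Rightarrow> 'b) \<Rightarrow> 'a topology \<Rightarrow> ('a \<Rightarrow> 'a) \<Rightarrow> bool" where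
  "factor_of Y R X T \<longleftrightarrow>
     (\<exists>\<pi>. continuous_map X Y \<pi> \<and> \<pi> ` topspace X = topspace Y \<and>
          (\<forall>x\<in>topspace X. \<pi> (T x) = R (\<pi> x)))"

text \<open>
  The averages are cast to \<^typ>\<open>ereal\<close> because \<^const>\<open>limsup\<close> needs a complete
  linear order. The term for \<open>n = 0\<close> is \<open>0\<close> and does not affect the limit superior.
\<close>

definition asymp_avg_pseudo_orbit ::
  "'a topology \<Rightarrow> ('a \<Rightarrow> 'a \<Rightarrow> real) \<Rightarrow> ('a \<Rightarrow> 'a) \<Rightarrow> (nat \<Rightarrow> 'a) \<Rightarrow> bool" where
  "asymp_avg_pseudo_orbit X \<rho> T x \<longleftrightarrow>
     (\<forall>n. x n \<in> topspace X) \<and>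
     limsup (\<lambda>n. ereal (1 / real n * (\<Sum>i<n. \<rho> (T (x i)) (x (Suc i))))) = 0"

definition asymp_avg_shadowing ::
  "'a topology \<Rightarrow> ('a \<Rightarrow> 'a \<Rightarrow> real) \<Rightarrow> ('a \<Rightarrow> 'a) \<Rightarrow> bool" where
  "asymp_avg_shadowing X \<rho> T \<longleftrightarrow>
     (\<forall>x. asymp_avg_pseudo_orbit X \<rho> T x \<longrightarrow>
        (\<exists>z\<in>topspace X.
           limsup (\<lambda>n. ereal (1 / real n * (\<Sum>i<n. \<rho> ((T ^^ i) z) (x i)))) = 0))"

end

theory Submission
  imports Defs
begin

text \<open>
  Uniform continuity turns an asymptotic average pseudo-orbit \<open>y\<close> of the factor into one that
  follows, on average, its own orbit segments of any fixed length. Diagonalizing, one may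
  cut the time axis into consecutive blocks whose lengths grow so slowly that replacing \<open>y\<close> on
  each block by the true orbit of the block's first point changes it by zero on average. Lifting
  only these first points and running the extension gives a sequence upstairs that jumps only at
  the block boundaries, a set of density zero. It is therefore an asymptotic average
  pseudo-orbit, and the projection of a point shadowing it shadows \<open>y\<close>.
\<close>

section \<open>Sequences whose running averages vanish\<close>

text \<open>Stated without division, so that \<open>n = 0\<close> is harmless, and only from above:
  for nonnegative sequences this is convergence of the Cesaro means to zero.\<close>

definition avg_null :: "(nat \<Rightarrow> real) \<Rightarrow> bool" where
  "avg_null a \<longleftrightarrow> (\<forall>e>0. \<exists>N. \<forall>n\<ge>N. (\<Sum>i<n. a i) \<le> e * real n)"

lemma avg_nullE:
  assumes "avg_null a" "0 < e"
  obtains N where "\<And>n. N \<le> n \<Longrightarrow> (\<Sum>i<n. a i) \<le> e * real n"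
  using assms unfolding avg_null_def by blast

text \<open>Translates both limit superior conditions of the theorem into \<open>avg_null\<close>.
  Nonnegative averages that eventually fall below every positive bound converge to 0, so their limit
  superior is exactly 0 and not something negative.\<close>

lemma limsup_avg_eq_0_iff:
  assumes "\<And>i. 0 \<le> a i"
  shows "limsup (\<lambda>n. ereal (1 / real n * (\<Sum>i<n. a i))) = 0 \<longleftrightarrow> avg_null a"
proof
  let ?f = "\<lambda>n. ereal (1 / real n * (\<Sum>i<n. a i))"
  assume L: "limsup ?f = 0"
  show "avg_null a"
    unfolding avg_null_def
  proof (intro allI impI)
    fix e :: real assume "e > 0"
    then have "limsup ?f < ereal e"
      using L by simp
    then have "\<forall>\<^sub>F n in sequentially. ?f n < ereal e"
      by (rule Limsup_lessD)
    then obtain N where N: "\<And>n. n \<ge> N \<Longrightarrow> ?f n < ereal e"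
      by (auto simp: eventually_sequentially)
    have "(\<Sum>i<n. a i) \<le> e * real n" if "n \<ge> N" for n
      using N[OF that] by (cases "n = 0") (auto simp: field_simps)
    then show "\<exists>N. \<forall>n\<ge>N. (\<Sum>i<n. a i) \<le> e * real n" by blast
  qed
next
  let ?g = "\<lambda>n. 1 / real n * (\<Sum>i<n. a i)"
  assume A: "avg_null a"
  have g0: "0 \<le> ?g n" for n
    using assms by (simp add: sum_nonneg)
  have "?g \<longlonglongrightarrow> 0"
  proof (rule LIMSEQ_I)
    fix r :: real assume "r > 0"
    then obtain N where N: "\<And>n. N \<le> n \<Longrightarrow> (\<Sum>i<n. a i) \<le> r/2 * real n"
      using avg_nullE[OF A, of "r/2"] by auto
    have "norm (?g n - 0) < r" if "n \<ge> N" for n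
    proof -
      have "?g n \<le> r/2"
        using N[OF that] \<open>r > 0\<close> by (cases "n = 0") (auto simp: field_simps)
      then show ?thesis
        using g0[of n] \<open>r > 0\<close> by (simp only: real_norm_def diff_0_right abs_of_nonneg)
    qed
    then show "\<exists>N. \<forall>n\<ge>N. norm (?g n - 0) < r" by blast
  qed
  then have "(\<lambda>n. ereal (?g n)) \<longlonglongrightarrow> ereal 0"
    by (rule tendsto_ereal)
  then show "limsup (\<lambda>n. ereal (?g n)) = 0"
    unfolding zero_ereal_def by (rule lim_imp_Limsup[OF sequentially_bot])
qed

lemma avg_null_zero: "avg_null (\<lambda>i. 0)"
  by (simp add: avg_null_def)

text \<open>The factor \<open>C\<close> may depend on \<open>e\<close>, because \<open>e\<close> is
  fixed before the averages of \<open>b\<close> are pushed below \<open>e/(2*C)\<close>. Uniform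
  continuity yields bounds of exactly this shape.\<close>

lemma avg_null_le_affine:
  assumes "\<And>e. e > 0 \<Longrightarrow> \<exists>C>0. \<forall>i. a i \<le> e + C * b i" and b: "avg_null b"
  shows "avg_null a"
  unfolding avg_null_def
proof (intro allI impI)
  fix e :: real assume "e > 0"
  then obtain C where C: "C > 0" "\<And>i. a i \<le> e/2 + C * b i"
    using assms(1)[of "e/2"] by auto
  obtain N where N: "\<And>n. N \<le> n \<Longrightarrow> (\<Sum>i<n. b i) \<le> e/(2*C) * real n"
    using avg_nullE[OF b, of "e/(2*C)"] \<open>e > 0\<close> C(1) by auto
  have "(\<Sum>i<n. a i) \<le> e * real n" if "n \<ge> N" for n
  proof -
    have "(\<Sum>i<n. a i) \<le> (\<Sum>i<n. e/2 + C * b i)"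
      using C by (intro sum_mono) auto
    also have "\<dots> = e/2 * real n + C * (\<Sum>i<n. b i)"
      by (simp add: sum.distrib sum_distrib_left)
    also have "\<dots> \<le> e/2 * real n + C * (e/(2*C) * real n)"
      using N[OF that] C(1) by (intro add_left_mono mult_left_mono) auto
    also have "\<dots> = e * real n"
      using C(1) by (simp add: field_simps)
    finally show ?thesis .
  qed
  then show "\<exists>N. \<forall>n\<ge>N. (\<Sum>i<n. a i) \<le> e * real n" by blast
qed

lemma avg_null_mono:
  assumes "\<And>i. a i \<le> b i" "avg_null b"
  shows "avg_null a"
  by (rule avg_null_le_affine[OF _ assms(2)])
    (use assms(1) in \<open>auto intro!: exI[of _ 1] add_increasing\<close>)

lemma avg_null_add:
  assumes "avg_null a" "avg_null b"
  shows "avg_null (\<lambda>i. a i + b i)"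
  unfolding avg_null_def
proof (intro allI impI)
  fix e :: real assume "e > 0"
  obtain M where M: "\<And>n. M \<le> n \<Longrightarrow> (\<Sum>i<n. a i) \<le> e/2 * real n"
    using avg_nullE[OF assms(1), of "e/2"] \<open>e > 0\<close> by auto
  obtain N where N: "\<And>n. N \<le> n \<Longrightarrow> (\<Sum>i<n. b i) \<le> e/2 * real n"
    using avg_nullE[OF assms(2), of "e/2"] \<open>e > 0\<close> by auto
  have "(\<Sum>i<n. a i + b i) \<le> e * real n" if "n \<ge> max M N" for n
    using M[of n] N[of n] that by (simp add: sum.distrib)
  then show "\<exists>N. \<forall>n\<ge>N. (\<Sum>i<n. a i + b i) \<le> e * real n" by blast
qed

lemma avg_null_sum:
  assumes "\<And>j. j \<in> J \<Longrightarrow> avg_null (a j)"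
  shows "avg_null (\<lambda>i. \<Sum>j\<in>J. a j i)"
  using assms
  by (induction J rule: infinite_finite_induct) (auto intro: avg_null_zero avg_null_add)

lemma avg_null_Suc:
  assumes "avg_null a" "\<And>i. 0 \<le> a i"
  shows "avg_null (\<lambda>i. a (Suc i))"
  unfolding avg_null_def
proof (intro allI impI)
  fix e :: real assume "e > 0"
  then obtain N where N: "\<And>n. N \<le> n \<Longrightarrow> (\<Sum>i<n. a i) \<le> e/2 * real n"
    using avg_nullE[OF assms(1), of "e/2"] by auto
  \<comment> \<open>The bound \<open>1 \<le> n\<close> lets half of \<open>e\<close> pay for the one
    extra term of the longer sum, since then \<open>n + 1 \<le> 2 * n\<close>.\<close>
  have "(\<Sum>i<n. a (Suc i)) \<le> e * real n" if "n \<ge> max 1 N" for n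
  proof -
    have "(\<Sum>i<n. a (Suc i)) \<le> (\<Sum>i<Suc n. a i)"
      using assms(2)[of 0] by (simp only: sum.lessThan_Suc_shift)
    also have "\<dots> \<le> e/2 * real (Suc n)"
      using N[of "Suc n"] that by simp
    also have "\<dots> \<le> e * real n"
    proof -
      have "e * 1 \<le> e * real n"
        using that \<open>e > 0\<close> by (intro mult_left_mono) auto
      then show ?thesis by (simp add: algebra_simps)
    qed
    finally show ?thesis .
  qed
  then show "\<exists>N. \<forall>n\<ge>N. (\<Sum>i<n. a (Suc i)) \<le> e * real n" by blast
qed

lemma avg_null_shift:
  assumes "avg_null a" "\<And>i. 0 \<le> a i"
  shows "avg_null (\<lambda>i. a (i + j))"
proof (induction j)
  case (Suc j)
  then show ?case
    using avg_null_Suc[of "\<lambda>i. a (i + j)"] assms(2) by simp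
qed (use assms in simp)

text \<open>The level \<open>L n\<close> rises to \<open>k\<close> only once the averages of
  \<open>E k\<close> are permanently at most \<open>1/k\<close>. Since \<open>L\<close> is monotone
  and \<open>E k i\<close> increases with \<open>k\<close>, the mixed sum up to \<open>n\<close> is
  dominated by the sum at the single last level.\<close>

lemma avg_null_diagonal:
  assumes null: "\<And>k. avg_null (E k)" and mono: "\<And>i. mono (\<lambda>k. E k i)"
  obtains L :: "nat \<Rightarrow> nat"
  where "filterlim L at_top sequentially" "avg_null (\<lambda>i. E (L i) i)"
proof -
  \<comment> \<open>Asking for the bound at all later \<open>m\<close> makes \<open>A\<close> grow
    with \<open>n\<close>, hence \<open>L\<close> monotone. The condition \<open>k \<le> n\<close>
    keeps \<open>A n\<close> finite, and the inserted 0 keeps it nonempty.\<close>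
  define P where "P k n \<longleftrightarrow> (\<forall>m>n. (\<Sum>i<m. E k i) \<le> 1 / real k * real m)" for k n
  define A where "A n = insert 0 {k. k \<le> n \<and> P k n}" for n
  define L where "L n = Max (A n)" for n
  have fin: "finite (A n)" and ne: "A n \<noteq> {}" for n
    by (auto simp: A_def)
  have "A m \<subseteq> A n" if "m \<le> n" for m n
    using that by (auto simp: A_def P_def)
  then have mono_L: "L m \<le> L n" if "m \<le> n" for m n
    using that unfolding L_def by (intro Max_mono fin ne) auto
  have large: "\<exists>N. \<forall>n\<ge>N. K \<le> L n" for K
  proof (cases "K = 0")
    case False
    then obtain N where N: "\<And>n. N \<le> n \<Longrightarrow> (\<Sum>i<n. E K i) \<le> 1 / real K * real n"
      using avg_nullE[OF null[of K], of "1 / real K"] by auto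
    have "K \<le> L n" if "n \<ge> max K N" for n
    proof -
      have "K \<in> A n"
        using that N by (auto simp: A_def P_def)
      then show ?thesis
        unfolding L_def using fin by (rule Max_ge[rotated])
    qed
    then show ?thesis by blast
  qed auto
  have "avg_null (\<lambda>i. E (L i) i)"
    unfolding avg_null_def
  proof (intro allI impI)
    fix e :: real assume "e > 0"
    obtain K :: nat where K: "K > 0" "1 / real K < e"
      using \<open>e > 0\<close> by (metis nat_approx_posE zero_less_Suc)
    obtain N where N: "\<And>n. n \<ge> N \<Longrightarrow> K \<le> L n"
      using large by blast
    have "(\<Sum>i<n. E (L i) i) \<le> e * real n" if n: "n \<ge> Suc N" for n
    proof -
      \<comment> \<open>This is the highest level used at times below \<open>n\<close>. The strict
        \<open>m > n\<close> in \<open>P\<close> makes \<open>P k (n - 1)\<close> apply at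
        \<open>n\<close> itself, and \<open>k \<ge> K > 0\<close> rules out the default 0.\<close>
      define k where "k = L (n - 1)"
      have k: "K \<le> k"
        using N n by (auto simp: k_def)
      have "k \<in> A (n - 1)"
        unfolding k_def L_def using fin ne by (rule Max_in)
      then have P: "P k (n - 1)"
        using k K(1) by (auto simp: A_def)
      have "(\<Sum>i<n. E (L i) i) \<le> (\<Sum>i<n. E k i)"
        by (intro sum_mono monoD[OF mono]) (auto simp: k_def intro: mono_L)
      also have "\<dots> \<le> 1 / real k * real n"
        using P n by (simp add: P_def)
      also have "\<dots> \<le> e * real n"
      proof (rule mult_right_mono)
        have "1 / real k \<le> 1 / real K"
          using k K(1) by (simp add: frac_le)
        then show "1 / real k \<le> e" using K(2) by simp
      qed simp
      finally show ?thesis .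
    qed
    then show "\<exists>N. \<forall>n\<ge>N. (\<Sum>i<n. E (L i) i) \<le> e * real n" by blast
  qed
  moreover have "filterlim L at_top sequentially"
    using large by (simp add: filterlim_at_top eventually_sequentially)
  ultimately show ?thesis using that by blast
qed

section \<open>Cutting time into blocks of slowly growing length\<close>

text \<open>
  The start of the block containing a given time, when a block starting at \<open>m\<close> has length
  \<open>L m + 1\<close>.
\<close>

primrec block_start :: "(nat \<Rightarrow> nat) \<Rightarrow> nat \<Rightarrow> nat" where
  "block_start L 0 = 0"
| "block_start L (Suc n) =
     (if L (block_start L n) < Suc n - block_start L n then Suc n else block_start L n)"

lemma block_start_le: "block_start L n \<le> n"
  by (induction n) auto

lemma block_offset_le: "n - block_start L n \<le> L (block_start L n)"
  by (induction n) auto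

text \<open>A time is determined by its block start \<open>m\<close> and its offset
  \<open>j \<le> L m\<close>, so the left side sums \<open>f\<close> over distinct pairs.
  Nonnegativity allows adding the missing pairs: those where \<open>m\<close> starts no block, and
  the tail of a block cut off at \<open>n\<close>.\<close>

lemma sum_blocks_le:
  assumes "\<And>m j. (0::real) \<le> f m j"
  shows "(\<Sum>i<n. f (block_start L i) (i - block_start L i)) \<le> (\<Sum>m<n. \<Sum>j\<le>L m. f m j)"
proof -
  let ?s = "block_start L"
  have "(\<Sum>i<n. f (?s i) (i - ?s i))
      = (\<Sum>m<n. \<Sum>i\<in>{i. i \<in> {..<n} \<and> ?s i = m}. f (?s i) (i - ?s i))"
    by (rule sum.group[symmetric]) (auto intro: le_less_trans[OF block_start_le])
  also have "\<dots> \<le> (\<Sum>m<n. \<Sum>j\<le>L m. f m j)"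
  proof (rule sum_mono)
    fix m
    let ?I = "{i. i \<in> {..<n} \<and> ?s i = m}"
    have ge: "m \<le> i" "i - m \<le> L m" if "i \<in> ?I" for i
      using that block_start_le[of L i] block_offset_le[of i L] by auto
    have inj: "inj_on (\<lambda>i. i - m) ?I"
      by (rule inj_onI) (metis ge(1) le_add_diff_inverse)
    have "(\<Sum>i\<in>?I. f (?s i) (i - ?s i)) = (\<Sum>i\<in>?I. f m (i - m))"
      by (rule sum.cong) auto
    also have "\<dots> = (\<Sum>j\<in>(\<lambda>i. i - m) ` ?I. f m j)"
      by (simp only: sum.reindex[OF inj] comp_def)
    also have "\<dots> \<le> (\<Sum>j\<le>L m. f m j)"
      using assms ge(2) by (intro sum_mono2) auto
    finally show "(\<Sum>i\<in>?I. f (?s i) (i - ?s i)) \<le> (\<Sum>j\<le>L m. f m j)" .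
  qed
  finally show ?thesis .
qed

text \<open>Block boundaries have density zero because block lengths tend to infinity along the
  starting times.\<close>

lemma avg_null_block_ends:
  assumes "filterlim L at_top sequentially"
  shows "avg_null (\<lambda>i. if block_start L (Suc i) = Suc i then 1 else 0)"
    (is "avg_null ?c")
  unfolding avg_null_def
proof (intro allI impI)
  let ?s = "block_start L"
  fix e :: real assume "e > 0"
  \<comment> \<open>Blocks longer than \<open>K\<close> produce boundaries with frequency at most
    \<open>1 / Suc K\<close>, which uses up one half of \<open>e\<close>.\<close>
  then obtain K :: nat where K: "1 / real (Suc K) < e / 2"
    using nat_approx_posE[of "e / 2"] by auto
  obtain N where N: "\<And>n. N \<le> n \<Longrightarrow> K \<le> L n"
    using assms by (auto simp: filterlim_at_top eventually_sequentially)
  define c where "c n = (\<Sum>i<n. if ?s (Suc i) = Suc i then 1 else (0::nat))" for n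
  \<comment> \<open>A boundary after a block starting at or beyond \<open>N\<close> is paid for by the length of that
    block; every other boundary increases \<open>min (?s n) N\<close>.\<close>
  have count: "Suc K * c n \<le> ?s n + Suc K * min (?s n) N" for n
  proof (induction n)
    case (Suc n)
    show ?case
    proof (cases "L (?s n) < Suc n - ?s n")
      case True
      then have s: "?s (Suc n) = Suc n" by simp
      have c: "c (Suc n) = Suc (c n)"
        using s by (simp add: c_def del: block_start.simps)
      show ?thesis
      proof (cases "N \<le> ?s n")
        case True
        then have "?s n + Suc K \<le> Suc n"
          using N[of "?s n"] \<open>L (?s n) < Suc n - ?s n\<close> by linarith
        moreover have "min (?s n) N = N" "min (Suc n) N = N"
          using True block_start_le[of L n] by auto
        ultimately show ?thesis
          using Suc unfolding s c by simp
      next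
        case False
        then have "Suc (min (?s n) N) \<le> min (Suc n) N"
          using block_start_le[of L n] by auto
        then have "Suc K * Suc (min (?s n) N) \<le> Suc K * min (Suc n) N"
          by (rule mult_le_mono2)
        then show ?thesis
          using Suc block_start_le[of L n] unfolding s c mult_Suc_right by linarith
      qed
    next
      case False
      then have s: "?s (Suc n) = ?s n" by simp
      then have "?s (Suc n) \<noteq> Suc n"
        using block_start_le[of L n] by linarith
      then have "c (Suc n) = c n"
        by (simp add: c_def del: block_start.simps)
      then show ?thesis using Suc s by simp
    qed
  qed (simp add: c_def)
  \<comment> \<open>Blocks starting before \<open>N\<close> may be short, but contribute at most
    \<open>N\<close> boundaries; from time \<open>M\<close> on the other half of \<open>e\<close>
    absorbs them.\<close>
  obtain M :: nat where M: "real N \<le> e / 2 * real M"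
    using reals_Archimedean3[of "e / 2"] \<open>e > 0\<close> by (metis half_gt_zero less_eq_real_def mult.commute)
  have "(\<Sum>i<n. ?c i) \<le> e * real n" if "n \<ge> M" for n
  proof -
    have "(\<Sum>i<n. ?c i) = real (c n)"
      unfolding c_def of_nat_sum by (rule sum.cong) auto
    moreover have "Suc K * c n \<le> n + Suc K * N"
      using count[of n] block_start_le[of L n]
      by (meson add_le_mono le_trans min.cobounded2 mult_le_mono2)
    then have "real (Suc K) * real (c n) \<le> real n + real (Suc K) * real N"
      by (metis of_nat_add of_nat_le_iff of_nat_mult)
    then have "real (c n) \<le> 1 / real (Suc K) * real n + real N"
      by (simp add: field_simps)
    moreover have "1 / real (Suc K) * real n \<le> e / 2 * real n"
      using K by (intro mult_right_mono) auto
    moreover have "e / 2 * real M \<le> e / 2 * real n"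
      using that \<open>e > 0\<close> by (intro mult_left_mono) auto
    ultimately show ?thesis using M by linarith
  qed
  then show "\<exists>N. \<forall>n\<ge>N. (\<Sum>i<n. ?c i) \<le> e * real n" by blast
qed

section \<open>Uniform continuity applied to average errors\<close>

lemma compatible_uniformly_continuous:
  assumes X: "compact_space X" "compatible_metric X \<rho>" and Y: "compatible_metric Y \<sigma>"
    and f: "continuous_map X Y f" and "e > 0"
  obtains d where "d > 0"
    "\<And>u v. \<lbrakk>u \<in> topspace X; v \<in> topspace X; \<rho> u v < d\<rbrakk> \<Longrightarrow> \<sigma> (f u) (f v) < e"
proof -
  interpret X: Metric_space "topspace X" \<rho> using X by (simp add: compatible_metric_def)
  interpret Y: Metric_space "topspace Y" \<sigma> using Y by (simp add: compatible_metric_def)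
  have "X.mtopology = X" "Y.mtopology = Y"
    using X Y by (simp_all add: compatible_metric_def)
  then have "uniformly_continuous_map (metric (topspace X, \<rho>)) (metric (topspace Y, \<sigma>)) f"
    using X(1) f by (subst continuous_eq_uniformly_continuous_map[symmetric]) simp_all
  then show ?thesis
    using that \<open>e > 0\<close> unfolding uniformly_continuous_map_def by auto
qed

lemma compatible_metric_nonneg: "compatible_metric X \<rho> \<Longrightarrow> 0 \<le> \<rho> x y"
  unfolding compatible_metric_def using Metric_space.nonneg by metis

text \<open>With \<open>d\<close> the modulus of uniform continuity for \<open>e\<close>, close
  pairs have image distance below \<open>e\<close>. For the others the diameter bound gives
  \<open>\<sigma> \<le> 1 \<le> \<rho> / d\<close>, so the affine criterion applies with
  \<open>C = 1 / d\<close>.\<close>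

lemma avg_null_continuous_image:
  assumes X: "compact_space X" "compatible_metric X \<rho>" and Y: "compatible_metric Y \<sigma>"
    and f: "continuous_map X Y f"
    and u: "\<And>i. u i \<in> topspace X" and v: "\<And>i. v i \<in> topspace X"
    and null: "avg_null (\<lambda>i. \<rho> (u i) (v i))"
  shows "avg_null (\<lambda>i. \<sigma> (f (u i)) (f (v i)))"
proof (rule avg_null_le_affine[OF _ null])
  fix e :: real assume "e > 0"
  obtain d where d: "d > 0"
    "\<And>u v. \<lbrakk>u \<in> topspace X; v \<in> topspace X; \<rho> u v < d\<rbrakk> \<Longrightarrow> \<sigma> (f u) (f v) < e"
    using compatible_uniformly_continuous[OF X Y f \<open>e > 0\<close>] by metis
  have "\<sigma> (f (u i)) (f (v i)) \<le> e + 1 / d * \<rho> (u i) (v i)" for i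
  proof (cases "\<rho> (u i) (v i) < d")
    case True
    then have "\<sigma> (f (u i)) (f (v i)) < e" using d u v by blast
    then show ?thesis
      using compatible_metric_nonneg[OF X(2), of "u i" "v i"] d(1) by (intro add_increasing2) auto
  next
    case False
    have "f (u i) \<in> topspace Y" "f (v i) \<in> topspace Y"
      using f u v by (auto simp: continuous_map_def)
    then have "\<sigma> (f (u i)) (f (v i)) \<le> 1"
      using Y by (simp add: compatible_metric_def)
    also have "1 \<le> 1 / d * \<rho> (u i) (v i)"
      using False d(1) by (simp add: field_simps)
    finally show ?thesis using \<open>e > 0\<close> by simp
  qed
  then show "\<exists>C>0. \<forall>i. \<sigma> (f (u i)) (f (v i)) \<le> e + C * \<rho> (u i) (v i)"
    using d(1) by (intro exI[of _ "1 / d"]) auto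
qed

lemma funpow_in_topspace:
  assumes "continuous_map X X T" "x \<in> topspace X"
  shows "(T ^^ n) x \<in> topspace X"
  using assms by (induction n) (auto simp: continuous_map_def)

text \<open>Induction on \<open>j\<close>: the error after \<open>j + 1\<close> steps is at most the
  \<open>R\<close>-image of the error after \<open>j\<close> steps, null by uniform continuity, plus
  the one-step error at time \<open>i + j\<close>, a shift of a null sequence.\<close>

lemma avg_null_pseudo_orbit_segments:
  assumes Y: "compact_space Y" "compatible_metric Y \<sigma>" and R: "continuous_map Y Y R"
    and y: "\<And>i. y i \<in> topspace Y"
    and null: "avg_null (\<lambda>i. \<sigma> (R (y i)) (y (Suc i)))"
  shows "avg_null (\<lambda>i. \<sigma> ((R ^^ j) (y i)) (y (i + j)))"
proof -
  interpret Metric_space "topspace Y" \<sigma> using Y by (simp add: compatible_metric_def)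
  note Rin = funpow_in_topspace[OF R]
  show ?thesis
  proof (induction j)
    case 0
    then show ?case using y by (simp add: avg_null_zero)
  next
    case (Suc j)
    have 1: "avg_null (\<lambda>i. \<sigma> (R ((R ^^ j) (y i))) (R (y (i + j))))"
      by (rule avg_null_continuous_image[OF Y Y(2) R _ _ Suc]) (auto intro: Rin y)
    have 2: "avg_null (\<lambda>i. \<sigma> (R (y (i + j))) (y (Suc (i + j))))"
      by (rule avg_null_shift[OF null]) simp
    have "\<sigma> ((R ^^ Suc j) (y i)) (y (i + Suc j))
      \<le> \<sigma> (R ((R ^^ j) (y i))) (R (y (i + j))) + \<sigma> (R (y (i + j))) (y (Suc (i + j)))" for i
      using triangle[of "(R ^^ Suc j) (y i)" "R (y (i + j))" "y (Suc (i + j))"]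
        Rin[OF y, of "Suc j"] Rin[OF y, of 1] y by simp
    then show ?case
      by (rule avg_null_mono[OF _ avg_null_add[OF 1 2]])
  qed
qed

section \<open>Lifting the pseudo-orbit and projecting the shadowing point\<close>

theorem corollary7p11:
  fixes X :: "'a topology" and T :: "'a \<Rightarrow> 'a" and \<rho> :: "'a \<Rightarrow> 'a \<Rightarrow> real"
    and Y :: "'b topology" and R :: "'b \<Rightarrow> 'b" and \<sigma> :: "'b \<Rightarrow> 'b \<Rightarrow> real"
  assumes "dynamical_system X T" and "compatible_metric X \<rho>"
    and "dynamical_system Y R" and "compatible_metric Y \<sigma>"
    and "factor_of Y R X T"
    and "asymp_avg_shadowing X \<rho> T"
  shows "asymp_avg_shadowing Y \<sigma> R"
  unfolding asymp_avg_shadowing_def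
proof (intro allI impI)
  fix y assume po: "asymp_avg_pseudo_orbit Y \<sigma> R y"
  have cX: "compact_space X" and T: "continuous_map X X T"
    and cY: "compact_space Y" and R: "continuous_map Y Y R"
    using assms(1,3) by (auto simp: dynamical_system_def)
  note TX = funpow_in_topspace[OF T] and RY = funpow_in_topspace[OF R]
  note \<rho>0 = compatible_metric_nonneg[OF assms(2)]
    and \<sigma>0 = compatible_metric_nonneg[OF assms(4)]
  interpret X: Metric_space "topspace X" \<rho> using assms(2) by (simp add: compatible_metric_def)
  interpret Y: Metric_space "topspace Y" \<sigma> using assms(4) by (simp add: compatible_metric_def)
  obtain \<pi> where \<pi>: "continuous_map X Y \<pi>" "\<pi> ` topspace X = topspace Y"
    and semi: "\<And>x. x \<in> topspace X \<Longrightarrow> \<pi> (T x) = R (\<pi> x)"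
    using assms(5) by (auto simp: factor_of_def)
  have semi_pow: "\<pi> ((T ^^ n) x) = (R ^^ n) (\<pi> x)" if "x \<in> topspace X" for n x
    by (induction n) (auto simp: semi TX that)
  have y: "y i \<in> topspace Y" for i
    using po by (simp add: asymp_avg_pseudo_orbit_def)
  have "avg_null (\<lambda>i. \<sigma> (R (y i)) (y (Suc i)))"
    using po limsup_avg_eq_0_iff[of "\<lambda>i. \<sigma> (R (y i)) (y (Suc i))"] \<sigma>0
    by (simp add: asymp_avg_pseudo_orbit_def)
  then have seg: "avg_null (\<lambda>i. \<sigma> ((R ^^ j) (y i)) (y (i + j)))" for j
    by (rule avg_null_pseudo_orbit_segments[OF cY assms(4) R y])
  \<comment> \<open>Summing the errors over a whole segment gives the monotonicity in
    \<open>k\<close> needed for the diagonal choice, and matches the total error of one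
    block.\<close>
  define E where "E k i = (\<Sum>j\<le>k. \<sigma> ((R ^^ j) (y i)) (y (i + j)))" for k i
  have "mono (\<lambda>k. E k i)" for i
    unfolding E_def by (intro monoI sum_mono2) (auto simp: \<sigma>0)
  moreover have "avg_null (E k)" for k
    unfolding E_def[abs_def] by (rule avg_null_sum) (rule seg)
  ultimately obtain L where L: "filterlim L at_top sequentially" "avg_null (\<lambda>i. E (L i) i)"
    using avg_null_diagonal[of E] by blast
  define s where "s = block_start L"
  have s_le: "s i \<le> i" for i
    by (simp add: s_def block_start_le)
  have "\<forall>i. \<exists>w. w \<in> topspace X \<and> \<pi> w = y i"
    using y \<pi>(2) by (metis imageE)
  then obtain w where w: "\<And>i. w i \<in> topspace X" "\<And>i. \<pi> (w i) = y i"
    by metis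
  \<comment> \<open>Lifts of \<open>y\<close> are chosen arbitrarily, with no continuity, and used
    only at block starts; in between \<open>x\<close> is a true orbit of \<open>T\<close>.\<close>
  define x where "x i = (T ^^ (i - s i)) (w (s i))" for i
  have x: "x i \<in> topspace X" for i
    by (simp add: x_def TX w)
  have "avg_null (\<lambda>i. \<rho> (T (x i)) (x (Suc i)))"
  proof (rule avg_null_mono[OF _ avg_null_block_ends[OF L(1)]])
    fix i
    have "\<rho> (T (x i)) (x (Suc i)) \<le> 1"
      using assms(2) x TX[OF x, of 1] by (simp add: compatible_metric_def)
    \<comment> \<open>Inside a block there is no jump, and at a boundary the jump is at most the
      diameter 1, so the boundary indicator dominates the errors.\<close>
    moreover have "\<rho> (T (x i)) (x (Suc i)) = 0" if "s (Suc i) \<noteq> Suc i"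
    proof -
      have "s (Suc i) = s i"
        using that by (auto simp: s_def split: if_splits)
      then have "x (Suc i) = T (x i)"
        using s_le[of i] by (simp add: x_def Suc_diff_le)
      then show ?thesis using x by (metis X.zero)
    qed
    ultimately show "\<rho> (T (x i)) (x (Suc i))
        \<le> (if block_start L (Suc i) = Suc i then 1 else 0)"
      by (auto simp: s_def simp del: block_start.simps)
  qed
  then have "asymp_avg_pseudo_orbit X \<rho> T x"
    unfolding asymp_avg_pseudo_orbit_def
    using x limsup_avg_eq_0_iff[of "\<lambda>i. \<rho> (T (x i)) (x (Suc i))"] \<rho>0 by blast
  then obtain z where z: "z \<in> topspace X"
    and "limsup (\<lambda>n. ereal (1 / real n * (\<Sum>i<n. \<rho> ((T ^^ i) z) (x i)))) = 0"
    using assms(6) by (auto simp: asymp_avg_shadowing_def)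
  then have "avg_null (\<lambda>i. \<rho> ((T ^^ i) z) (x i))"
    using limsup_avg_eq_0_iff[of "\<lambda>i. \<rho> ((T ^^ i) z) (x i)"] \<rho>0 by blast
  then have "avg_null (\<lambda>i. \<sigma> (\<pi> ((T ^^ i) z)) (\<pi> (x i)))"
    by (rule avg_null_continuous_image[OF cX assms(2,4) \<pi>(1) TX[OF z] x])
  moreover have "avg_null (\<lambda>i. \<sigma> (\<pi> (x i)) (y i))"
    unfolding avg_null_def
  proof (intro allI impI)
    fix e :: real assume "e > 0"
    then obtain N where N: "\<And>n. N \<le> n \<Longrightarrow> (\<Sum>i<n. E (L i) i) \<le> e * real n"
      using avg_nullE[OF L(2)] by metis
    \<comment> \<open>The projection of \<open>x\<close> on a block is the \<open>R\<close>-orbit of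
      \<open>y\<close> at the block start. Writing \<open>i\<close> as start plus offset makes each
      block's error part of \<open>E (L m) m\<close>, with \<open>m\<close> that start.\<close>
    have "(\<Sum>i<n. \<sigma> (\<pi> (x i)) (y i)) \<le> (\<Sum>i<n. E (L i) i)" for n
    proof -
      have "(\<Sum>i<n. \<sigma> (\<pi> (x i)) (y i))
          = (\<Sum>i<n. \<sigma> ((R ^^ (i - s i)) (y (s i))) (y (s i + (i - s i))))"
        using s_le by (simp add: x_def semi_pow w)
      also have "\<dots> \<le> (\<Sum>i<n. E (L i) i)"
        unfolding s_def E_def
        by (rule sum_blocks_le[where f = "\<lambda>m j. \<sigma> ((R ^^ j) (y m)) (y (m + j))"]) (rule \<sigma>0)
      finally show ?thesis .
    qed
    then show "\<exists>N. \<forall>n\<ge>N. (\<Sum>i<n. \<sigma> (\<pi> (x i)) (y i)) \<le> e * real n"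
      using N order_trans by meson
  qed
  ultimately have "avg_null (\<lambda>i. \<sigma> (\<pi> ((T ^^ i) z)) (\<pi> (x i)) + \<sigma> (\<pi> (x i)) (y i))"
    by (rule avg_null_add)
  moreover have in_Y: "\<pi> v \<in> topspace Y" if "v \<in> topspace X" for v
    using \<pi>(2) that by blast
  ultimately have "avg_null (\<lambda>i. \<sigma> (\<pi> ((T ^^ i) z)) (y i))"
    by (intro avg_null_mono[OF Y.triangle[OF in_Y[OF TX[OF z]] in_Y[OF x] y]])
  then have "avg_null (\<lambda>i. \<sigma> ((R ^^ i) (\<pi> z)) (y i))"
    by (simp add: semi_pow z)
  then have "limsup (\<lambda>n. ereal (1 / real n * (\<Sum>i<n. \<sigma> ((R ^^ i) (\<pi> z)) (y i)))) = 0"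
    using limsup_avg_eq_0_iff[of "\<lambda>i. \<sigma> ((R ^^ i) (\<pi> z)) (y i)"] \<sigma>0 by blast
  then show "\<exists>z\<in>topspace Y.
      limsup (\<lambda>n. ereal (1 / real n * (\<Sum>i<n. \<sigma> ((R ^^ i) z) (y i)))) = 0"
    using in_Y[OF z] by blast
qed

end
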